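(* Let $(A,\ast,\alpha)$ be a Hom-Jacobi-Jordan algebra. Then $(A,\ast,\alpha)$ is a Hom-Jordan algebra.
   Context: All vector spaces and algebras are over a ground field $\mathbb{K}$ of characteristic $0$. A Hom-algebra is a triple $(A,\mu,\alpha)$ where $A$ is a vector space, $\alpha:A\to A$ is linear and $\mu:A\otimes A\to A$ is linear (a bilinear product); it is multiplicative if $\alpha(\mu(x,y))=\mu(\alpha(x),\alpha(y))$ for all $x,y\in A$. A Hom-Jacobi-Jordan algebra is a multiplicative Hom-algebra $(A,\ast,\alpha)$ such that $x\ast y=y\ast x$ and $(x\ast y)\ast\alpha(z)+(y\ast z)\ast\alpha(x)+(z\ast x)\ast\alpha(y)=0$ for all $x,y,z\in A$. The Hom-associator of $(A,\ast,\alpha)$ is $as_\alpha(x,y,z)=(x\ast y)\ast\alpha(z)-\alpha(x)\ast(y\ast z)$. A Hom-Jordan algebra is a multiplicative Hom-algebra $(A,\ast,\alpha)$ such that $x\ast y=y\ast x$ and $as_\alpha(x\ast x,\alpha(y),\alpha(x))=0$ for all $x,y\in A$. *)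

theory Defs
  imports Complex_Main
begin

locale hom_algebra = vector_space scale
  for scale :: "'k::field_char_0 \<Rightarrow> 'a::ab_group_add \<Rightarrow> 'a" (infixr "*s" 75) +
  fixes mu :: "'a \<Rightarrow> 'a \<Rightarrow> 'a" (infixl "\<star>" 70)
    and alpha :: "'a \<Rightarrow> 'a"
  assumes linear_alpha: "Vector_Spaces.linear scale scale alpha"
    and linear_mu_left: "\<And>y. Vector_Spaces.linear scale scale (\<lambda>x. x \<star> y)"
    and linear_mu_right: "\<And>x. Vector_Spaces.linear scale scale (\<lambda>y. x \<star> y)"

locale multiplicative_hom_algebra = hom_algebra +
  assumes multiplicative: "alpha (x \<star> y) = alpha x \<star> alpha y"

definition hom_associator ::
  "('a \<Rightarrow> 'a \<Rightarrow> 'a) \<Rightarrow> ('a \<Rightarrow> 'a) \<Rightarrow> 'a \<Rightarrow> 'a \<Rightarrow> 'a \<Rightarrow> 'a::ab_group_add"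
  where "hom_associator mu alpha x y z = mu (mu x y) (alpha z) - mu (alpha x) (mu y z)"

locale hom_jacobi_jordan_algebra = multiplicative_hom_algebra +
  assumes commute: "x \<star> y = y \<star> x"
    and hom_jacobi: "(x \<star> y) \<star> alpha z + (y \<star> z) \<star> alpha x + (z \<star> x) \<star> alpha y = 0"

locale hom_jordan_algebra = multiplicative_hom_algebra +
  assumes commute: "x \<star> y = y \<star> x"
    and hom_jordan: "hom_associator mu alpha (x \<star> x) (alpha y) (alpha x) = 0"

end

theory Submission
  imports Defs
begin

text \<open>
  Write \<open>xy\<close> for the product. The Hom-Jacobi identity with a repeated argument says
  \<open>(xx)\<alpha>(y) = - 2 (xy)\<alpha>(x)\<close>, and the Hom-Jordan identity follows from two uses of this
  consequence. The first use turns \<open>((xx)\<alpha>(y))\<alpha>(\<alpha>(x))\<close> into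
  \<open>- 2 ((xy)\<alpha>(x))\<alpha>(\<alpha>(x))\<close>. The second use is at the elements \<open>\<alpha>(x)\<close> and \<open>xy\<close>, read
  from right to left: it absorbs the factor \<open>- 2\<close> again and gives
  \<open>(\<alpha>(x)\<alpha>(x))\<alpha>(xy)\<close>, which by multiplicativity and commutativity is
  \<open>\<alpha>(xx)(\<alpha>(y)\<alpha>(x))\<close>.
\<close>

context hom_jacobi_jordan_algebra
begin

text \<open>
  Two of the three cyclic terms of the Hom-Jacobi identity coincide when an argument is repeated.
  The factor 2 is written as a sum, so that only additivity of the product matters later.
\<close>

lemma square_mult_alpha:
  "(x \<star> x) \<star> alpha y = - ((x \<star> y) \<star> alpha x + (x \<star> y) \<star> alpha x)"
  using hom_jacobi[of x x y] commute[of y x]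
  by (simp add: add.assoc eq_neg_iff_add_eq_0 del: minus_add_distrib)

lemma hom_jordan_identity:
  "hom_associator mu alpha (x \<star> x) (alpha y) (alpha x) = 0"
proof -
  let ?p = "(x \<star> y) \<star> alpha x"
  interpret right_mult: Vector_Spaces.linear scale scale "\<lambda>u. u \<star> alpha (alpha x)"
    by (rule linear_mu_left)
  have "((x \<star> x) \<star> alpha y) \<star> alpha (alpha x)
      = - (?p \<star> alpha (alpha x) + ?p \<star> alpha (alpha x))"
    unfolding square_mult_alpha[of x y] by (simp only: right_mult.neg right_mult.add)
  also have "\<dots> = (alpha x \<star> alpha x) \<star> alpha (x \<star> y)"
    unfolding square_mult_alpha[of "alpha x" "x \<star> y"] commute[of "alpha x" "x \<star> y"] ..
  also have "\<dots> = alpha (x \<star> x) \<star> (alpha y \<star> alpha x)"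
    by (simp only: multiplicative commute[of "alpha x" "alpha y"])
  finally show ?thesis
    by (simp add: hom_associator_def)
qed

end

theorem proposition3p5:
  fixes scale :: "'k::field_char_0 \<Rightarrow> 'a::ab_group_add \<Rightarrow> 'a"
    and mu :: "'a \<Rightarrow> 'a \<Rightarrow> 'a"
    and alpha :: "'a \<Rightarrow> 'a"
  assumes "hom_jacobi_jordan_algebra scale mu alpha"
  shows "hom_jordan_algebra scale mu alpha"
proof -
  interpret hom_jacobi_jordan_algebra scale mu alpha
    by (rule assms)
  show ?thesis
    by unfold_locales (rule commute, rule hom_jordan_identity)
qed

end
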